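(* Let $d\in\{-163,-67,-43,-19,-11,-7,-3,-2,-1\}$ and $z\in\mathcal O_{\mathbb{Q}(\sqrt{d})}\setminus\{0\}$, with $I_n^*$ computed in $\mathcal O_{\mathbb{Q}(\sqrt{d})}$. For every integer $n\ge 4$, $I_n^*(z)<2$. Furthermore, if $I_3^*(z)$ is rational, then $I_3^*(z)<2$.
   Context: $\mathcal O_{\mathbb{Q}(\sqrt{d})}$ is $\mathbb{Z}[\frac{1+\sqrt d}{2}]$ if $d\equiv 1 \pmod 4$ and $\mathbb{Z}[\sqrt d]$ if $d\equiv 2,3\pmod 4$; for the listed $d$ it is a unique factorization domain. Viewing elements as complex numbers, $|z|=\sqrt{z\bar z}$ and $\arg(z)\in[0,2\pi)$. Define $A(d)$ to be the set of nonzero $z\in\mathcal O_{\mathbb{Q}(\sqrt{d})}$ with $0\le\arg(z)<\pi/2$ if $d=-1$, with $0\le \arg(z)<\pi/3$ if $d=-3$, and with $0\le\arg(z)<\pi$ otherwise. Two elements are relatively prime if they have no nonunit common divisor. For nonzero $x,z$, write $x\Diamond z$ iff $x\in A(d)$, $x\mid z$, and $x$ is relatively prime to $z/x$. For $m\in\mathbb{Z}$ define $\delta_m^*(z)=\sum_{x\Diamond z}|x|^m$ and $I_m^*(z)=\delta_m^*(z)/|z|^m$ for nonzero $z$. *)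

theory Defs
  imports "HOL-Analysis.Analysis"
begin

definition csqrt_int :: "int \<Rightarrow> complex" where
  "csqrt_int d = (if d < 0 then \<i> * complex_of_real (sqrt (real_of_int (- d)))
                  else complex_of_real (sqrt (real_of_int d)))"

definition OK :: "int \<Rightarrow> complex set" where
  "OK d = (if d mod 4 = 1
           then {of_int a + of_int b * ((1 + csqrt_int d) / 2) | a b. True}
           else {of_int a + of_int b * csqrt_int d | a b. True})"

definition OK_dvd :: "int \<Rightarrow> complex \<Rightarrow> complex \<Rightarrow> bool" where
  "OK_dvd d x z \<longleftrightarrow> x \<in> OK d \<and> z \<in> OK d \<and> (\<exists>y \<in> OK d. z = x * y)"

definition OK_unit :: "int \<Rightarrow> complex \<Rightarrow> bool" where
  "OK_unit d u \<longleftrightarrow> OK_dvd d u 1"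

definition OK_coprime :: "int \<Rightarrow> complex \<Rightarrow> complex \<Rightarrow> bool" where
  "OK_coprime d x y \<longleftrightarrow> (\<forall>c. OK_dvd d c x \<and> OK_dvd d c y \<longrightarrow> OK_unit d c)"

definition Aset :: "int \<Rightarrow> complex set" where
  "Aset d = {z \<in> OK d. z \<noteq> 0 \<and>
     (if d = -1 then Arg2pi z < pi / 2
      else if d = -3 then Arg2pi z < pi / 3
      else Arg2pi z < pi)}"

definition unitary_div :: "int \<Rightarrow> complex \<Rightarrow> complex \<Rightarrow> bool" where
  "unitary_div d x z \<longleftrightarrow> x \<noteq> 0 \<and> z \<noteq> 0 \<and> x \<in> Aset d \<and> OK_dvd d x z \<and> OK_coprime d x (z / x)"

definition delta_star :: "int \<Rightarrow> int \<Rightarrow> complex \<Rightarrow> real" where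
  "delta_star d m z = (\<Sum>x \<in> {x. unitary_div d x z}. norm x powi m)"

definition I_star :: "int \<Rightarrow> int \<Rightarrow> complex \<Rightarrow> real" where
  "I_star d m z = delta_star d m z / norm z powi m"

end

theory Submission
  imports Defs "HOL-Computational_Algebra.Nth_Powers"
begin

text \<open>Dividing by |z|^n turns I_n*(z) into a sum of |y|^(-n) over the cofactors y = z/x, which are
  pairwise non-associated and so may be moved into A(d) by units. For n >= 4 even the full lattice
  sum of |y|^(-4) over A(d) is below 2. For n = 3 the summands are positive rational multiples of
  square roots of the integers N(y) = |y|^2; such a sum is rational only if every N(y) is a perfect
  square m^2, and there are so few elements of A(d) of norm m^2 that the sum of their m^(-3) is again
  below 2.\<close>

text \<open>Both bounds are proved for arbitrary finite subsets of the sector, so z enters only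
  through its set of cofactors. At exponent 4 the tightest case is d = -7, where the full sum is
  zeta(2) * L(2, \<chi>) \<approx> 1.895 for the quadratic character \<chi> of conductor 7; this
  small margin dictates how precise the finite computation must be. At exponent 3 the full sum can
  be too large: over A(-1) it is about 2.26. Rationality must therefore thin out the terms. Linear
  independence of square roots is avoided: all coefficients are positive, so a nonsquare norm yields
  a prime p for which the sum equals A + B * sqrt p with B > 0 and with A and B in a field that does
  not contain sqrt p. Solving for sqrt p is the contradiction.\<close>

section \<open>Rational sums of square roots\<close>

text \<open>The field generated over the rationals by the square roots of the members of
  \<open>P\<close>. The closure rules make adjoining one root an induction; \<open>inverse\<close>
  can be unconditional because \<open>inverse 0 = 0\<close>.\<close>

inductive_set sqrt_field :: "nat set \<Rightarrow> real set" for P :: "nat set" where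
  Rats: "x \<in> \<rat> \<Longrightarrow> x \<in> sqrt_field P"
| sqrt: "p \<in> P \<Longrightarrow> sqrt (real p) \<in> sqrt_field P"
| add: "x \<in> sqrt_field P \<Longrightarrow> y \<in> sqrt_field P \<Longrightarrow> x + y \<in> sqrt_field P"
| mult: "x \<in> sqrt_field P \<Longrightarrow> y \<in> sqrt_field P \<Longrightarrow> x * y \<in> sqrt_field P"
| inverse: "x \<in> sqrt_field P \<Longrightarrow> inverse x \<in> sqrt_field P"

lemma sqrt_field_uminus: "x \<in> sqrt_field P \<Longrightarrow> - x \<in> sqrt_field P"
  using sqrt_field.mult[OF sqrt_field.Rats[of "-1"], of x P] by simp

lemma sqrt_field_diff: "x \<in> sqrt_field P \<Longrightarrow> y \<in> sqrt_field P \<Longrightarrow> x - y \<in> sqrt_field P"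
  using sqrt_field.add[OF _ sqrt_field_uminus, of x P y] by simp

lemma sqrt_field_divide: "x \<in> sqrt_field P \<Longrightarrow> y \<in> sqrt_field P \<Longrightarrow> x / y \<in> sqrt_field P"
  by (simp add: divide_inverse sqrt_field.intros)

lemma sqrt_field_of_nat: "real n \<in> sqrt_field P"
  by (simp add: sqrt_field.Rats)

lemma sqrt_field_sum:
  "(\<And>t. t \<in> T \<Longrightarrow> f t \<in> sqrt_field P) \<Longrightarrow> sum f T \<in> sqrt_field P"
  by (induction T rule: infinite_finite_induct) (auto intro: sqrt_field.intros)

lemma sqrt_field_prod:
  "(\<And>t. t \<in> T \<Longrightarrow> f t \<in> sqrt_field P) \<Longrightarrow> prod f T \<in> sqrt_field P"
  by (induction T rule: infinite_finite_induct) (auto intro: sqrt_field.intros)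

lemma sqrt_field_power: "x \<in> sqrt_field P \<Longrightarrow> x ^ n \<in> sqrt_field P"
  by (induction n) (auto intro: sqrt_field.intros)

lemma sqrt_field_empty: "x \<in> sqrt_field {} \<Longrightarrow> x \<in> \<rat>"
  by (induction rule: sqrt_field.induct) auto

lemma sqrt_field_insert:
  assumes "x \<in> sqrt_field (insert p P)"
  shows "\<exists>a\<in>sqrt_field P. \<exists>b\<in>sqrt_field P. x = a + b * sqrt (real p)"
  using assms
proof induction
  case (Rats x)
  then show ?case by (intro bexI[of _ x] bexI[of _ 0]) (auto intro: sqrt_field.Rats)
next
  case (sqrt q)
  show ?case
  proof (cases "q = p")
    case True
    then show ?thesis by (intro bexI[of _ 0] bexI[of _ 1]) (auto intro: sqrt_field.Rats)
  next
    case False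
    with sqrt have "sqrt (real q) \<in> sqrt_field P" by (auto intro: sqrt_field.sqrt)
    then show ?thesis by (intro bexI[of _ "sqrt (real q)"] bexI[of _ 0]) (auto intro: sqrt_field.Rats)
  qed
next
  case (add x y)
  then obtain a b c d where *: "a \<in> sqrt_field P" "b \<in> sqrt_field P" "c \<in> sqrt_field P" "d \<in> sqrt_field P"
    "x = a + b * sqrt (real p)" "y = c + d * sqrt (real p)" by blast
  show ?case
    by (intro bexI[of _ "a + c"] bexI[of _ "b + d"]) (auto simp: * algebra_simps intro: sqrt_field.intros *)
next
  case (mult x y)
  then obtain a b c d where *: "a \<in> sqrt_field P" "b \<in> sqrt_field P" "c \<in> sqrt_field P" "d \<in> sqrt_field P"
    "x = a + b * sqrt (real p)" "y = c + d * sqrt (real p)" by blast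
  have "x * y = (a * c + b * d * (sqrt (real p) * sqrt (real p))) + (a * d + b * c) * sqrt (real p)"
    unfolding * by (simp only: algebra_simps)
  then have "x * y = (a * c + b * d * real p) + (a * d + b * c) * sqrt (real p)" by simp
  then show ?case
    by (intro bexI[of _ "a * c + b * d * real p"] bexI[of _ "a * d + b * c"])
       (auto intro!: sqrt_field.add sqrt_field.mult sqrt_field_of_nat *)
next
  case (inverse x)
  then obtain a b where *: "a \<in> sqrt_field P" "b \<in> sqrt_field P" "x = a + b * sqrt (real p)" by blast
  show ?case
  \<comment> \<open>The inverse comes from the conjugate, which fails when the norm a^2 - b^2 * p
    vanishes. In that case b = 0 or sqrt p is \<bar>a / b\<bar>, so x already lies in the smaller
    field.\<close>
  proof (cases "a\<^sup>2 = b\<^sup>2 * real p")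
    case True
    have "x \<in> sqrt_field P"
    proof (cases "b = 0")
      case False
      have "(a / b)\<^sup>2 = real p" using True False by (simp add: field_simps)
      then have "sqrt (real p) = \<bar>a / b\<bar>" by (metis real_sqrt_abs)
      also have "\<dots> \<in> sqrt_field P"
        using sqrt_field_divide[OF *(1,2)] sqrt_field_uminus by (auto simp: abs_if)
      finally show ?thesis unfolding * by (auto intro!: sqrt_field.add sqrt_field.mult *)
    qed (use * in auto)
    then show ?thesis
      by (intro bexI[of _ "inverse x"] bexI[of _ 0]) (auto intro: sqrt_field.inverse sqrt_field.Rats)
  next
    case False
    let ?n = "a\<^sup>2 - b\<^sup>2 * real p"
    have "(a + b * sqrt (real p)) * (a - b * sqrt (real p)) = ?n"
      by (simp add: algebra_simps power2_eq_square)
    then have n: "x * (a - b * sqrt (real p)) = ?n" by (simp only: *)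
    moreover have "?n \<noteq> 0" using False by simp
    ultimately have "x \<noteq> 0" "a - b * sqrt (real p) \<noteq> 0" by auto
    then have "inverse x = (a - b * sqrt (real p)) / ?n"
      unfolding n[symmetric] by (simp add: field_simps)
    also have "\<dots> = a / ?n + (- b / ?n) * sqrt (real p)"
      by (simp add: diff_divide_distrib)
    finally have "inverse x = a / ?n + (- b / ?n) * sqrt (real p)" .
    moreover have "?n \<in> sqrt_field P"
      by (intro sqrt_field_diff sqrt_field.mult sqrt_field_power sqrt_field_of_nat *)
    ultimately show ?thesis
      by (intro bexI[of _ "a / ?n"] bexI[of _ "- b / ?n"])
         (auto intro: sqrt_field_divide sqrt_field_uminus *)
  qed
qed

text \<open>One root is adjoined at a time. The claim concerns every n of odd valuation at p, with p
  and n both general, because the induction step uses it for n * q at p and also for q at q. Over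
  the rationals it is the parity of valuations in n * b^2 = a^2.\<close>

lemma sqrt_notin_sqrt_field:
  fixes n :: nat
  assumes "finite P" "\<And>q. q \<in> P \<Longrightarrow> prime q" "prime p" "p \<notin> P" "odd (multiplicity p n)"
  shows "sqrt (real n) \<notin> sqrt_field P"
  using assms
proof (induction P arbitrary: p n rule: finite_induct)
  case empty
  have "n \<noteq> 0" using empty by (intro notI) auto
  show ?case
  proof
    assume "sqrt (real n) \<in> sqrt_field {}"
    then have "sqrt (real n) \<in> \<rat>" by (rule sqrt_field_empty)
    then obtain a b :: nat where ab: "b \<noteq> 0" "\<bar>sqrt (real n)\<bar> = real a / real b"
      by (rule Rats_abs_nat_div_natE)
    then have "sqrt (real n) * real b = real a" by (simp add: field_simps)
    then have "(sqrt (real n) * real b)\<^sup>2 = (real a)\<^sup>2" by simp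
    then have "real (n * b\<^sup>2) = real (a\<^sup>2)" by (simp add: power_mult_distrib)
    then have eq: "n * b\<^sup>2 = a\<^sup>2" by (simp only: of_nat_eq_iff)
    then have "a \<noteq> 0" using ab \<open>n \<noteq> 0\<close> by (intro notI) auto
    have "multiplicity p (n * b\<^sup>2) = multiplicity p n + 2 * multiplicity p b"
      using empty ab \<open>n \<noteq> 0\<close>
      by (simp add: prime_elem_multiplicity_mult_distrib prime_elem_multiplicity_power_distrib)
    moreover have "multiplicity p (a\<^sup>2) = 2 * multiplicity p a"
      using empty \<open>a \<noteq> 0\<close> by (simp add: prime_elem_multiplicity_power_distrib)
    ultimately have "multiplicity p n + 2 * multiplicity p b = 2 * multiplicity p a"
      using eq by simp
    then show False using empty by presburger
  qed
next
  case (insert q P)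
  have n0: "n \<noteq> 0" using insert.prems by (intro notI) auto
  have q0: "prime q" "q \<noteq> 0" using insert.prems(1)[of q] by (auto dest: prime_gt_0_nat)
  have pq: "p \<noteq> q" "p \<notin> P" using insert.prems by auto
  show ?case
  proof
    assume "sqrt (real n) \<in> sqrt_field (insert q P)"
    then obtain a b where *: "a \<in> sqrt_field P" "b \<in> sqrt_field P"
      "sqrt (real n) = a + b * sqrt (real q)"
      using sqrt_field_insert by blast
    have "real n = (a + b * sqrt (real q))\<^sup>2" using * by (metis of_nat_0_le_iff real_sqrt_pow2)
    then have sq: "real n = a\<^sup>2 + b\<^sup>2 * real q + 2 * a * b * sqrt (real q)"
      by (simp add: power2_sum power_mult_distrib)
    consider "b = 0" | "a = 0" | "a \<noteq> 0" "b \<noteq> 0" by blast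
    then show False
    proof cases
      case 1
      then show False using * insert.IH[of p n] insert.prems pq by auto
    next
      case 2
      have "sqrt (real (n * q)) = b * real q" using * 2 by (simp add: real_sqrt_mult)
      moreover have "multiplicity p (n * q) = multiplicity p n"
        using insert.prems n0 q0 pq
        by (simp add: prime_elem_multiplicity_mult_distrib prime_multiplicity_other)
      ultimately show False
        using insert.IH[of p "n * q"] insert.prems pq * sqrt_field.mult sqrt_field_of_nat by auto
    next
      case 3
      \<comment> \<open>With both coefficients nonzero, the cross term of the square can be solved
        for sqrt q, which puts sqrt q into the smaller field.\<close>
      have "sqrt (real q) = (real n - a\<^sup>2 - b\<^sup>2 * real q) / (2 * a * b)"
        using 3 sq by (simp add: field_simps)
      also have "\<dots> \<in> sqrt_field P"
        using sqrt_field_of_nat[of 2]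
        by (intro sqrt_field_divide sqrt_field_diff sqrt_field.mult sqrt_field_power sqrt_field_of_nat *) auto
      finally show False using insert.IH[of q q] insert.prems insert.hyps q0 by auto
    qed
  qed
qed

lemma real_sqrt_prod: "sqrt (prod f A) = (\<Prod>x\<in>A. sqrt (f x))"
  by (induction A rule: infinite_finite_induct) (simp_all add: real_sqrt_mult)

text \<open>In the prime factorization of n, an even power of sqrt p is an integer, so only roots of
  members of \<open>P\<close> remain.\<close>

lemma sqrt_in_sqrt_field:
  fixes n :: nat
  assumes "n \<noteq> 0" "even (multiplicity p n)" "prime_factors n \<subseteq> insert p P"
  shows "sqrt (real n) \<in> sqrt_field P"
proof -
  have "n = (\<Prod>q\<in>prime_factors n. q ^ multiplicity q n)"
    using prime_factorization_nat[of n] assms(1) by simp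
  then have "real n = real (\<Prod>q\<in>prime_factors n. q ^ multiplicity q n)"
    by (rule arg_cong)
  then have "real n = (\<Prod>q\<in>prime_factors n. real q ^ multiplicity q n)"
    by (simp only: of_nat_prod of_nat_power)
  then have "sqrt (real n) = (\<Prod>q\<in>prime_factors n. sqrt (real q) ^ multiplicity q n)"
    by (simp add: real_sqrt_prod real_sqrt_power)
  also have "\<dots> \<in> sqrt_field P"
  proof (intro sqrt_field_prod)
    fix q assume q: "q \<in> prime_factors n"
    show "sqrt (real q) ^ multiplicity q n \<in> sqrt_field P"
    proof (cases "q = p")
      case True
      then obtain j where "multiplicity q n = 2 * j" using assms(2) by (auto elim: evenE)
      then have "sqrt (real q) ^ multiplicity q n = real q ^ j" by (simp add: power_mult)
      then show ?thesis by (simp add: sqrt_field_power sqrt_field_of_nat)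
    next
      case False
      with q assms(3) have "q \<in> P" by blast
      then show ?thesis by (intro sqrt_field_power sqrt_field.sqrt)
    qed
  qed
  finally show ?thesis .
qed

text \<open>A nonsquare \<open>N s\<close> has odd valuation at some prime p. Terms of even
  valuation at p go into A; the others contribute a multiple of sqrt p. Positivity of the
  coefficients rules out cancellation in that multiple.\<close>

lemma sum_sqrt_rational_imp_squares:
  fixes c :: "'a \<Rightarrow> real" and N :: "'a \<Rightarrow> nat"
  assumes fin: "finite T" and c: "\<And>t. t \<in> T \<Longrightarrow> c t \<in> \<rat> \<and> c t > 0"
    and N: "\<And>t. t \<in> T \<Longrightarrow> N t > 0"
    and rat: "(\<Sum>t\<in>T. c t * sqrt (real (N t))) \<in> \<rat>" and s: "s \<in> T"
  shows "\<exists>m. N s = m\<^sup>2"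
proof (rule ccontr)
  assume "\<nexists>m. N s = m\<^sup>2"
  then have "\<not> is_nth_power 2 (N s)" by (auto simp: is_nth_power_def)
  then obtain p where p: "prime p" "odd (multiplicity p (N s))"
    using N[OF s] by (auto simp: is_nth_power_conv_multiplicity_nat)
  define P where "P = (\<Union>t\<in>T. prime_factors (N t)) - {p}"
  have P: "finite P" "\<And>q. q \<in> P \<Longrightarrow> prime q" "p \<notin> P" using fin by (auto simp: P_def)
  have sub: "prime_factors (N t) \<subseteq> insert p P" if "t \<in> T" for t using that by (auto simp: P_def)
  define E where "E = {t\<in>T. even (multiplicity p (N t))}"
  define A where "A = (\<Sum>t\<in>E. c t * sqrt (real (N t)))"
  \<comment> \<open>Taking one factor p out of a term of odd valuation leaves even valuation, so
    what remains avoids sqrt p.\<close>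
  define B where "B = (\<Sum>t\<in>T-E. c t * sqrt (real (N t div p)))"
  have odd_div: "N t = p * (N t div p)" "N t div p \<noteq> 0" "even (multiplicity p (N t div p))" 
     "prime_factors (N t div p) \<subseteq> insert p P" if "t \<in> T - E" for t
  proof -
    have o: "odd (multiplicity p (N t))" "t \<in> T" using that by (auto simp: E_def)
    then have "multiplicity p (N t) \<noteq> 0" by (intro notI) simp
    then have "p dvd N t" by (rule contrapos_np) (rule not_dvd_imp_multiplicity_0)
    then show 1: "N t = p * (N t div p)" by simp
    show 2: "N t div p \<noteq> 0" using N[OF o(2)] \<open>p dvd N t\<close> p(1)
      by (simp add: dvd_div_eq_0_iff)
    have "multiplicity p (p * (N t div p)) = multiplicity p p + multiplicity p (N t div p)"
      using p 2 prime_gt_0_nat[of p] by (intro prime_elem_multiplicity_mult_distrib) auto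
    then have "multiplicity p (N t) = multiplicity p p + multiplicity p (N t div p)"
      by (simp only: 1[symmetric])
    then show "even (multiplicity p (N t div p))"
      using o p by (simp add: prime_gt_1_nat)
    show "prime_factors (N t div p) \<subseteq> insert p P"
    proof -
      have "N t div p dvd N t" by (rule dvdI[of _ _ p], subst mult.commute, rule 1)
      with N[OF o(2)] have "prime_factors (N t div p) \<subseteq> prime_factors (N t)"
        by (intro dvd_prime_factors) auto
      with sub[OF o(2)] show ?thesis by blast
    qed
  qed
  have "E \<subseteq> T" by (auto simp: E_def)
  have "A \<in> sqrt_field P" unfolding A_def
  proof (intro sqrt_field_sum sqrt_field.mult sqrt_in_sqrt_field[of _ p])
    fix t assume "t \<in> E"
    then have "t \<in> T" "even (multiplicity p (N t))" by (simp_all add: E_def)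
    then show "c t \<in> sqrt_field P" "N t \<noteq> 0" "even (multiplicity p (N t))"
      "prime_factors (N t) \<subseteq> insert p P"
      using c N[of t] sub[of t] by (auto intro!: sqrt_field.Rats)
  qed
  moreover have "B \<in> sqrt_field P" unfolding B_def
    using c odd_div(2-4)
    by (intro sqrt_field_sum sqrt_field.mult sqrt_in_sqrt_field[of _ p]) (blast intro: sqrt_field.Rats)+
  moreover have "B > 0" unfolding B_def
  proof (rule sum_pos)
    show "T - E \<noteq> {}" using s p by (auto simp: E_def)
    fix t assume t: "t \<in> T - E"
    then show "c t * sqrt (real (N t div p)) > 0" 
      using c[of t] odd_div(2)[OF t] by (intro mult_pos_pos) auto
  qed (use fin in auto)
  moreover have "(\<Sum>t\<in>T. c t * sqrt (real (N t))) = A + B * sqrt (real p)"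
  proof -
    have "(\<Sum>t\<in>T. c t * sqrt (real (N t))) = (\<Sum>t\<in>T-E. c t * sqrt (real (N t))) + A"
      unfolding A_def using fin \<open>E \<subseteq> T\<close> by (rule sum.subset_diff[rotated])
    also have "(\<Sum>t\<in>T-E. c t * sqrt (real (N t))) = B * sqrt (real p)"
      unfolding B_def sum_distrib_right
    proof (rule sum.cong[OF refl])
      fix t assume "t \<in> T - E"
      then have "real (N t) = real p * real (N t div p)" using odd_div(1) by (metis of_nat_mult)
      then show "c t * sqrt (real (N t)) = c t * sqrt (real (N t div p)) * sqrt (real p)"
        by (simp add: real_sqrt_mult)
    qed
    finally show ?thesis by simp
  qed
  ultimately have "sqrt (real p) = ((\<Sum>t\<in>T. c t * sqrt (real (N t))) - A) / B" by simp
  also have "\<dots> \<in> sqrt_field P"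
    by (intro sqrt_field_divide sqrt_field_diff \<open>A \<in> _\<close> \<open>B \<in> _\<close> sqrt_field.Rats rat)
  finally show False
    using sqrt_notin_sqrt_field[of P p p] P p by auto
qed

section \<open>Moving cofactors into a sector\<close>

lemma rotate_into_sector:
  fixes y :: complex and w :: nat
  assumes "y \<noteq> 0" "w > 0"
  shows "\<exists>k::nat. Arg2pi (cis (2 * pi / w) ^ k * y) < 2 * pi / w"
proof -
  define \<alpha> where "\<alpha> = 2 * pi / real w"
  have \<alpha>: "\<alpha> > 0" "real w * \<alpha> = 2 * pi" using assms by (auto simp: \<alpha>_def)
  \<comment> \<open>j is the number of whole sectors below the argument of y. Turning back by j
    sectors is written as turning forward by w - j, because exponents are natural numbers.\<close>
  define j where "j = nat \<lfloor>Arg2pi y / \<alpha>\<rfloor>"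
  have "Arg2pi y / \<alpha> \<ge> 0" using \<alpha> Arg2pi_ge_0[of y] by simp
  then have "real j = of_int \<lfloor>Arg2pi y / \<alpha>\<rfloor>" by (simp add: j_def)
  then have "real j \<le> Arg2pi y / \<alpha>" "Arg2pi y / \<alpha> < real j + 1" by linarith+
  then have j: "real j * \<alpha> \<le> Arg2pi y" "Arg2pi y < (real j + 1) * \<alpha>"
    using \<alpha> by (simp_all add: field_simps)
  have "real j * \<alpha> < real w * \<alpha>" using j(1) \<alpha> Arg2pi_lt_2pi[of y] by linarith
  then have "j < w" using mult_less_cancel_right_pos[OF \<alpha>(1)] by simp
  have "cis \<alpha> ^ (w - j) = cis (real (w - j) * \<alpha>)" by (rule Complex.DeMoivre)
  also have "real (w - j) * \<alpha> = 2 * pi - real j * \<alpha>"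
    using \<open>j < w\<close> \<alpha> by (simp add: of_nat_diff left_diff_distrib)
  finally have *: "cis \<alpha> ^ (w - j) * y = cis (2 * pi - real j * \<alpha>) * (of_real (norm y) * cis (Arg2pi y))"
    using Arg2pi_eq[of y] by (simp add: cis_conv_exp)
  have "cis (2 * pi - real j * \<alpha>) * cis (Arg2pi y) = cis (Arg2pi y - real j * \<alpha> + 2 * pi)"
    by (simp add: cis_mult algebra_simps)
  also have "\<dots> = cis (Arg2pi y - real j * \<alpha>)"
    by (simp add: cis_mult[symmetric])
  finally have "of_real (norm y) * cis (Arg2pi y - real j * \<alpha>) = cis \<alpha> ^ (w - j) * y"
    unfolding * by (simp only: mult.left_commute)
  then have "of_real (norm y) * exp (\<i> * of_real (Arg2pi y - real j * \<alpha>)) = cis \<alpha> ^ (w - j) * y"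
    by (simp only: cis_conv_exp)
  then have "Arg2pi (cis \<alpha> ^ (w - j) * y) = Arg2pi y - real j * \<alpha>"
  proof (rule Arg2pi_unique)
    have "real j * \<alpha> \<ge> 0" using \<alpha> by simp
    then show "Arg2pi y - real j * \<alpha> < 2 * pi" using Arg2pi_lt_2pi[of y] by linarith
  qed (use assms j in auto)
  also have "\<dots> < \<alpha>" using j by (simp add: algebra_simps)
  finally show ?thesis unfolding \<alpha>_def by blast
qed

text \<open>Both arguments lie in [0, \<alpha>), so they differ by less than \<alpha>; but they
  differ by an integer multiple of \<alpha>, hence not at all.\<close>

lemma sector_unique:
  fixes x :: complex and w k :: nat
  assumes "w > 0" "Arg2pi x < 2 * pi / w" "Arg2pi (cis (2 * pi / w) ^ k * x) < 2 * pi / w"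
  shows "cis (2 * pi / w) ^ k * x = x"
proof (cases "x = 0")
  case False
  define \<alpha> where "\<alpha> = 2 * pi / real w"
  have \<alpha>: "\<alpha> > 0" "real w * \<alpha> = 2 * pi" using assms by (auto simp: \<alpha>_def)
  define y where "y = cis \<alpha> ^ k * x"
  have "norm y = norm x" by (simp add: y_def norm_mult norm_power)
  have "of_real (norm x) * cis (Arg2pi y) = y"
    using Arg2pi_eq[of y] \<open>norm y = norm x\<close> by (simp add: cis_conv_exp)
  also have "y = cis (real k * \<alpha>) * (of_real (norm x) * cis (Arg2pi x))"
    using Arg2pi_eq[of x] unfolding y_def Complex.DeMoivre by (simp add: cis_conv_exp)
  finally have "cis (Arg2pi y) = cis (real k * \<alpha> + Arg2pi x)"
    using False by (simp add: cis_mult[symmetric] mult_ac)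
  then obtain n :: int where n: "real k * \<alpha> + Arg2pi x = Arg2pi y + 2 * pi * of_int n"
    using sin_cos_eq_iff[of "real k * \<alpha> + Arg2pi x" "Arg2pi y"]
    by (auto simp: cis.code complex_eq_iff)
  have "(of_int (int k - int w * n)) * \<alpha> = Arg2pi y - Arg2pi x"
    using n \<alpha>(2) by (simp add: algebra_simps)
  moreover have "\<bar>Arg2pi y - Arg2pi x\<bar> < 1 * \<alpha>"
    using assms Arg2pi_ge_0[of x] Arg2pi_ge_0[of y] unfolding \<alpha>_def[symmetric] y_def[symmetric] by linarith
  ultimately have "\<bar>real_of_int (int k - int w * n)\<bar> * \<alpha> < 1 * \<alpha>"
    using \<alpha> by (metis abs_mult abs_of_pos)
  then have "\<bar>real_of_int (int k - int w * n)\<bar> < 1" using \<alpha> by simp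
  then have "int k - int w * n = 0" by linarith
  with n \<alpha> have "Arg2pi x = Arg2pi y"
    using \<open>(of_int (int k - int w * n)) * \<alpha> = Arg2pi y - Arg2pi x\<close> by simp
  then have "x = y" using Arg2pi_eq[of x] Arg2pi_eq[of y] \<open>norm y = norm x\<close> by simp
  then show ?thesis by (simp add: y_def \<alpha>_def)
qed simp

section \<open>The ring as a lattice, and its rotations by units\<close>

definition ring_gen :: "int \<Rightarrow> complex" where
  "ring_gen d = (if d mod 4 = 1 then (1 + csqrt_int d) / 2 else csqrt_int d)"

lemma OK_iff: "z \<in> OK d \<longleftrightarrow> (\<exists>a b. z = of_int a + of_int b * ring_gen d)"
  by (auto simp: OK_def ring_gen_def)

text \<open>With this w, the three sectors that define A(d) all have opening 2 * pi / w, and for the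
  listed d the units are the w-th roots of unity. This allows a uniform treatment.\<close>

definition unit_count :: "int \<Rightarrow> nat" where
  "unit_count d = (if d = -1 then 4 else if d = -3 then 6 else 2)"

lemma Aset_iff: "z \<in> Aset d \<longleftrightarrow> z \<in> OK d \<and> z \<noteq> 0 \<and> Arg2pi z < 2 * pi / real (unit_count d)"
  by (auto simp: Aset_def unit_count_def)

lemma OK_rotate:
  assumes "z \<in> OK d"
  shows "cis (2 * pi / real (unit_count d)) * z \<in> OK d"
proof -
  obtain a b where z: "z = of_int a + of_int b * ring_gen d" using assms OK_iff by blast
  consider "d = -1" | "d = -3" | "d \<noteq> -1" "d \<noteq> -3" by blast
  then show ?thesis
  proof cases
    case 1
    have "cis (2 * pi / real (unit_count d)) * z = of_int (-b) + of_int a * ring_gen d"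
      using 1 by (simp add: z unit_count_def ring_gen_def csqrt_int_def cis.code complex_eq_iff)
    then show ?thesis unfolding OK_iff by blast
  next
    case 2
    have c: "2 * pi / real (unit_count d) = pi / 3" using 2 by (simp add: unit_count_def)
    \<comment> \<open>Here the rotation is multiplication by \<omega> = \<open>ring_gen d\<close>
      itself, and \<omega>^2 = \<omega> - 1.\<close>
    have "cis (2 * pi / real (unit_count d)) * z = of_int (-b) + of_int (a + b) * ring_gen d"
      unfolding c using 2
      by (simp add: z ring_gen_def csqrt_int_def cis.code complex_eq_iff cos_60 sin_60 field_simps)
    then show ?thesis unfolding OK_iff by blast
  next
    case 3
    have "cis (2 * pi / real (unit_count d)) * z = of_int (-a) + of_int (-b) * ring_gen d"
      using 3 by (simp add: z unit_count_def cis.code complex_eq_iff)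
    then show ?thesis unfolding OK_iff by blast
  qed
qed

lemma OK_rotate_power:
  "z \<in> OK d \<Longrightarrow> cis (2 * pi / real (unit_count d)) ^ k * z \<in> OK d"
  by (induction k) (auto simp: mult.assoc intro: OK_rotate)

text \<open>T consists of the cofactors z/x of the unitary divisors x, rotated into the sector by units;
  they stay distinct because no two x are associated.\<close>

lemma I_star_sum_over_Aset:
  assumes "z \<noteq> 0"
  obtains T where "finite T" "T \<subseteq> Aset d" "\<And>n. I_star d n z = (\<Sum>t\<in>T. 1 / norm t powi n)"
proof (cases "finite {x. unitary_div d x z}")
  case False \<comment> \<open>delta_star is then 0, the value of a sum over an infinite set\<close>
  then show ?thesis by (intro that[of "{}"]) (auto simp: I_star_def delta_star_def)
next
  case True
  define S where "S = {x. unitary_div d x z}"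
  define w where "w = unit_count d"
  define \<zeta> where "\<zeta> = cis (2 * pi / real w)"
  have w: "w > 0" by (simp add: w_def unit_count_def)
  have \<zeta>w: "\<zeta> ^ w = 1" using w unfolding \<zeta>_def Complex.DeMoivre by simp
  have S: "x \<noteq> 0" "x \<in> Aset d" "z / x \<in> OK d" if "x \<in> S" for x
    using that assms by (auto simp: S_def unitary_div_def OK_dvd_def)
  have "\<exists>k::nat. Arg2pi (\<zeta> ^ k * (z / x)) < 2 * pi / w" if "x \<in> S" for x
    unfolding \<zeta>_def using S[OF that] assms w by (intro rotate_into_sector) auto
  then obtain k where k: "\<And>x. x \<in> S \<Longrightarrow> Arg2pi (\<zeta> ^ k x * (z / x)) < 2 * pi / w"
    by metis
  define f where "f x = \<zeta> ^ k x * (z / x)" for x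
  have f: "f x \<in> Aset d" if "x \<in> S" for x
  proof -
    have "f x \<in> OK d" unfolding f_def \<zeta>_def w_def by (rule OK_rotate_power[OF S(3)[OF that]])
    moreover have "f x \<noteq> 0" using assms S[OF that] by (simp add: f_def \<zeta>_def)
    ultimately show ?thesis using k[OF that] by (simp add: Aset_iff w_def f_def)
  qed
  have nf: "norm (f x) = norm z / norm x" for x
    by (simp add: f_def \<zeta>_def norm_mult norm_power norm_divide)
  have inj: "inj_on f S"
  proof (rule inj_onI)
    fix x y assume xy: "x \<in> S" "y \<in> S" "f x = f y"
    then have "\<zeta> ^ k x * y = \<zeta> ^ k y * x"
      using S[OF xy(1)] S[OF xy(2)] assms by (simp add: f_def field_simps)
    \<comment> \<open>The factor is the inverse of \<open>\<zeta> ^ k x\<close>, since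
      \<open>\<zeta> ^ w = 1\<close>. It shows that y is a rotation of x, and two associates in one
      sector coincide.\<close>
    then have "\<zeta> ^ ((w - 1) * k x) * (\<zeta> ^ k x * y) = \<zeta> ^ ((w - 1) * k x) * (\<zeta> ^ k y * x)"
      by simp
    then have "\<zeta> ^ ((w - 1) * k x + k x) * y = \<zeta> ^ ((w - 1) * k x + k y) * x"
      by (simp add: power_add mult_ac)
    moreover have "(w - 1) * k x + k x = w * k x" using w by (cases w) auto
    ultimately have "y = \<zeta> ^ ((w - 1) * k x + k y) * x" by (simp add: power_mult \<zeta>w)
    moreover have "\<zeta> ^ ((w - 1) * k x + k y) * x = x"
      unfolding \<zeta>_def
      using S(2)[OF xy(1)] S(2)[OF xy(2)] w calculation
      by (intro sector_unique) (auto simp: Aset_iff w_def \<zeta>_def)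
    ultimately show "x = y" by simp
  qed
  show ?thesis
  proof (rule that[of "f ` S"])
    show "finite (f ` S)" using True by (simp add: S_def)
    show "f ` S \<subseteq> Aset d" using f by blast
    fix n
    have "I_star d n z = (\<Sum>x\<in>S. norm x powi n / norm z powi n)"
      by (simp add: I_star_def delta_star_def S_def sum_divide_distrib)
    also have "\<dots> = (\<Sum>x\<in>S. 1 / norm (f x) powi n)"
      by (intro sum.cong) (auto simp: nf power_int_divide_distrib)
    also have "\<dots> = (\<Sum>t\<in>f ` S. 1 / norm t powi n)" by (simp add: sum.reindex[OF inj])
    finally show "I_star d n z = (\<Sum>t\<in>f ` S. 1 / norm t powi n)" .
  qed
qed

section \<open>Lattice sums\<close>

definition lattice_box :: "nat \<Rightarrow> (int \<times> int) set" where
  "lattice_box M = {- int M..int M} \<times> {0..int M}"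

text \<open>The shell between boxes M - 1 and M has 4 * M + 1 \<le> 5 * M points, so it contributes
  at most 5 * C / M^3. Replacing M^3 by the smaller (M - 1) * M * (M + 1) makes the shells
  telescope.\<close>

lemma lattice_sum_bound:
  fixes f :: "int \<times> int \<Rightarrow> real"
  assumes T: "finite T" "\<And>p. p \<in> T \<Longrightarrow> snd p \<ge> 0"
    and K: "K > 0" and C: "C \<ge> 0"
    and f: "\<And>p. f p \<ge> 0"
    and tail: "\<And>p M. M > K \<Longrightarrow> p \<in> lattice_box M - lattice_box (M - 1) \<Longrightarrow> f p \<le> C / real M ^ 4"
  shows "sum f T \<le> sum f (lattice_box K) + 5 * C / (2 * real K * (real K + 1))"
proof -
  have fin: "finite (lattice_box M)" for M by (simp add: lattice_box_def)
  have mono: "lattice_box M \<subseteq> lattice_box N" if "M \<le> N" for M N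
    using that by (auto simp: lattice_box_def)
  have card: "int (card (lattice_box M)) = (2 * int M + 1) * (int M + 1)" for M
    by (simp add: lattice_box_def card_cartesian_product)
  have box: "sum f (lattice_box M) \<le> sum f (lattice_box K) +
      5 * C / 2 * (1 / (real K * (real K + 1)) - 1 / (real M * (real M + 1)))" if "M \<ge> K" for M
    using that
  proof (induction M rule: dec_induct)
    case (step M)
    let ?S = "lattice_box (Suc M) - lattice_box M"
    have "int (card ?S) = int (card (lattice_box (Suc M))) - int (card (lattice_box M))"
      using mono[of M "Suc M"] fin by (simp add: card_Diff_subset card_mono)
    also have "\<dots> \<le> 5 * int (Suc M)" unfolding card by (simp add: algebra_simps)
    finally have c: "real (card ?S) \<le> 5 * real (Suc M)" by linarith
    have "M > 0" using step K by simp
    have "sum f ?S \<le> real (card ?S) * (C / real (Suc M) ^ 4)"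
      using step tail[of "Suc M"] by (intro sum_bounded_above) auto
    also have "\<dots> \<le> 5 * real (Suc M) * (C / real (Suc M) ^ 4)"
      using c C by (intro mult_right_mono) auto
    also have "\<dots> = 5 * C * (1 / real (Suc M) ^ 3)"
      by (simp add: divide_simps eval_nat_numeral)
    also have "1 / real (Suc M) ^ 3 \<le> 1 / (real M * (real M + 1) * (real M + 2))"
    proof (rule divide_left_mono)
      show "real M * (real M + 1) * (real M + 2) \<le> real (Suc M) ^ 3"
        by (simp add: algebra_simps eval_nat_numeral)
      show "0 < real (Suc M) ^ 3 * (real M * (real M + 1) * (real M + 2))"
        using \<open>M > 0\<close> by (intro mult_pos_pos) auto
    qed simp
    also have "1 / (real M * (real M + 1) * (real M + 2)) =
        (1 / (real M * (real M + 1)) - 1 / (real (Suc M) * (real (Suc M) + 1))) / 2"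
      using \<open>M > 0\<close> by (simp add: divide_simps) (simp add: algebra_simps)
    finally have "sum f ?S \<le> 5 * C / 2 *
        (1 / (real M * (real M + 1)) - 1 / (real (Suc M) * (real (Suc M) + 1)))"
      using C by (simp add: mult_left_mono)
    moreover have "sum f (lattice_box (Suc M)) = sum f ?S + sum f (lattice_box M)"
      by (rule sum.subset_diff) (use mono[of M "Suc M"] fin in auto)
    ultimately show ?case using step.IH by (simp add: algebra_simps)
  qed simp
  \<comment> \<open>Any box that contains T will do; the sum of all coordinates in absolute value
    bounds each of them.\<close>
  define M where "M = K + (\<Sum>p\<in>T. nat \<bar>fst p\<bar> + nat \<bar>snd p\<bar>)"
  have "T \<subseteq> lattice_box M"
  proof
    fix p assume p: "p \<in> T"
    then have "nat \<bar>fst p\<bar> + nat \<bar>snd p\<bar> \<le> (\<Sum>p\<in>T. nat \<bar>fst p\<bar> + nat \<bar>snd p\<bar>)"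
      using T(1) by (intro member_le_sum) auto
    then have "nat \<bar>fst p\<bar> + nat \<bar>snd p\<bar> \<le> M" by (simp add: M_def)
    then show "p \<in> lattice_box M" using T(2)[OF p]
      by (cases p) (auto simp: lattice_box_def)
  qed
  then have "sum f T \<le> sum f (lattice_box M)"
    using fin f by (intro sum_mono2) auto
  also have "\<dots> \<le> sum f (lattice_box K) +
      5 * C / 2 * (1 / (real K * (real K + 1)) - 1 / (real M * (real M + 1)))"
    by (rule box) (simp add: M_def)
  also have "\<dots> \<le> sum f (lattice_box K) + 5 * C / 2 * (1 / (real K * (real K + 1)))"
    using C by (intro add_left_mono mult_left_mono) auto
  finally show ?thesis by simp
qed

definition half_plane :: "(int \<times> int) set" where
  "half_plane = {(a, b). b > 0 \<or> b = 0 \<and> a > 0}"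

text \<open>In the basis 1, \<open>ring_gen d\<close>, this one set serves both the right angle for
  d = -1 and the angle pi / 3 for d = -3.\<close>

definition quadrant :: "(int \<times> int) set" where
  "quadrant = {(a, b). a > 0 \<and> b \<ge> 0}"

text \<open>Rounding the terms 1/Q^2 up to multiples of 10^-6 keeps the finite part of the lattice
  sum within integer arithmetic.\<close>

lemma sum_inverse_square_lt_2:
  fixes Q :: "int \<times> int \<Rightarrow> int"
  assumes T: "finite T" "T \<subseteq> R" and R: "\<And>p. p \<in> R \<Longrightarrow> snd p \<ge> 0 \<and> Q p > 0"
    and Q: "\<And>a b. 8 * Q (a, b) \<ge> 7 * a\<^sup>2" "\<And>a b. 8 * Q (a, b) \<ge> 7 * b\<^sup>2"
    and box: "(\<Sum>p\<in>lattice_box 8. if p \<in> R then 10 ^ 6 div (Q p)\<^sup>2 + 1 else 0) \<le> 1950000"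
  shows "(\<Sum>p\<in>T. 1 / (real_of_int (Q p))\<^sup>2) < 2"
proof -
  define f where "f p = (if p \<in> R then 1 / (real_of_int (Q p))\<^sup>2 else 0)" for p
  have "(\<Sum>p\<in>T. 1 / (real_of_int (Q p))\<^sup>2) = sum f T"
    using T by (intro sum.cong) (auto simp: f_def)
  \<comment> \<open>Here 64 / 49 is the square of 8 / 7. The tail beyond the box is about 0.0454,
    which together with the 1.95 allowed inside it stays below 2.\<close>
  also have "\<dots> \<le> sum f (lattice_box 8) + 5 * (64 / 49) / (2 * real 8 * (real 8 + 1))"
  proof (rule lattice_sum_bound)
    fix p M assume M: "M > (8::nat)" and p: "p \<in> lattice_box M - lattice_box (M - 1)"
    obtain a b where ab: "p = (a, b)" by (cases p)
    \<comment> \<open>On the shell the maximum norm is exactly M.\<close>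
    from p M have "\<bar>a\<bar> = int M \<or> b = int M" by (auto simp: ab lattice_box_def)
    then have "a\<^sup>2 = (int M)\<^sup>2 \<or> b\<^sup>2 = (int M)\<^sup>2" by (metis power2_abs)
    then have "7 * (int M)\<^sup>2 \<le> 8 * Q p" using Q(1)[of a b] Q(2)[of b a] by (auto simp: ab)
    then have "real_of_int (7 * (int M)\<^sup>2) \<le> real_of_int (8 * Q p)" by (simp only: of_int_le_iff)
    then have "7 / 8 * (real M)\<^sup>2 \<le> real_of_int (Q p)" by simp
    then have "(7 / 8 * (real M)\<^sup>2)\<^sup>2 \<le> (real_of_int (Q p))\<^sup>2" by (intro power_mono) auto
    then have "1 / (real_of_int (Q p))\<^sup>2 \<le> 1 / (7 / 8 * (real M)\<^sup>2)\<^sup>2"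
      using M by (intro divide_left_mono mult_pos_pos) (auto intro: less_le_trans[rotated])
    also have "\<dots> = 64 / 49 / real M ^ 4"
      by (simp add: power_mult_distrib power_divide flip: power_mult)
    finally show "f p \<le> 64 / 49 / real M ^ 4" by (auto simp: f_def)
  qed (use T R in \<open>auto simp: f_def\<close>)
  also have "sum f (lattice_box 8) \<le> (\<Sum>p\<in>lattice_box 8.
      of_int (if p \<in> R then 10 ^ 6 div (Q p)\<^sup>2 + 1 else 0) / 10 ^ 6)"
  proof (rule sum_mono)
    fix p
    show "f p \<le> of_int (if p \<in> R then 10 ^ 6 div (Q p)\<^sup>2 + 1 else 0) / 10 ^ 6"
    proof (cases "p \<in> R")
      case True
      define q where "q = (Q p)\<^sup>2"
      have "q > 0" using R[OF True] by (simp add: q_def)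
      have "10 ^ 6 = q * (10 ^ 6 div q) + 10 ^ 6 mod q" by simp
      moreover have "10 ^ 6 mod q < q" using \<open>q > 0\<close> by simp
      ultimately have "10 ^ 6 \<le> q * (10 ^ 6 div q + 1)"
        unfolding distrib_left by linarith
      then have "real_of_int (10 ^ 6) \<le> real_of_int (q * (10 ^ 6 div q + 1))"
        by (simp only: of_int_le_iff)
      then have "1 / real_of_int q \<le> of_int (10 ^ 6 div q + 1) / 10 ^ 6"
        using \<open>q > 0\<close> by (simp add: field_simps)
      then show ?thesis using True by (simp add: f_def q_def)
    qed (simp add: f_def)
  qed
  also have "\<dots> = of_int (\<Sum>p\<in>lattice_box 8. if p \<in> R then 10 ^ 6 div (Q p)\<^sup>2 + 1 else 0) / 10 ^ 6"
    by (simp add: sum_divide_distrib)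
  also have "\<dots> \<le> of_int 1950000 / 10 ^ 6"
    using box by (intro divide_right_mono) (simp_all only: of_int_le_iff, simp)
  finally show ?thesis by simp
qed

lemma lattice_sum_7:
  assumes "finite T" "T \<subseteq> half_plane"
  shows "(\<Sum>(a, b)\<in>T. 1 / (real_of_int (a\<^sup>2 + a * b + 2 * b\<^sup>2))\<^sup>2) < 2"
proof -
  let ?Q = "\<lambda>(a :: int, b :: int). a\<^sup>2 + a * b + 2 * b\<^sup>2"
  \<comment> \<open>Completing the square in b and in a. The first identity is the source of the
    constant 7 / 8: it is the minimum of the form over real b at a = 1.\<close>
  have q: "8 * (a\<^sup>2 + a * b + 2 * b\<^sup>2) = 7 * a\<^sup>2 + (a + 4 * b)\<^sup>2"
    "8 * (a\<^sup>2 + a * b + 2 * b\<^sup>2) = 7 * b\<^sup>2 + 2 * (2 * a + b)\<^sup>2 + 7 * b\<^sup>2" for a b :: int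
    by (simp_all add: power2_eq_square algebra_simps)
  have "(\<Sum>p\<in>T. 1 / (real_of_int (?Q p))\<^sup>2) < 2"
  proof (rule sum_inverse_square_lt_2[OF assms])
    fix a b :: int
    show "8 * ?Q (a, b) \<ge> 7 * a\<^sup>2" "8 * ?Q (a, b) \<ge> 7 * b\<^sup>2"
      using q[of a b] zero_le_power2[of "a + 4 * b"] zero_le_power2[of "2 * a + b"]
        zero_le_power2[of b] unfolding case_prod_conv by linarith+
  next
    fix p assume "p \<in> half_plane"
    moreover obtain a b where p: "p = (a, b)" by (cases p)
    ultimately have "b > 0 \<or> b = 0 \<and> a > 0" by (simp add: half_plane_def)
    moreover have "?Q p > 0" if "b > 0"
    proof -
      have "b\<^sup>2 > 0" using that by simp
      moreover have "2 * (2 * a + b)\<^sup>2 \<ge> 0" by simp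
      ultimately have "8 * ?Q p > 0" unfolding p case_prod_conv q(2)[of a b] by linarith
      then show ?thesis by simp
    qed
    ultimately show "snd p \<ge> 0 \<and> ?Q p > 0" by (auto simp: p)
  next
    show "(\<Sum>p\<in>lattice_box 8. if p \<in> half_plane then 10 ^ 6 div (?Q p)\<^sup>2 + 1 else 0) \<le> 1950000"
      unfolding lattice_box_def half_plane_def mem_Collect_eq by code_simp
  qed
  then show ?thesis by (simp add: case_prod_unfold)
qed

lemma lattice_sum_8:
  assumes "finite T" "T \<subseteq> half_plane"
  shows "(\<Sum>(a, b)\<in>T. 1 / (real_of_int (a\<^sup>2 + 2 * b\<^sup>2))\<^sup>2) < 2"
proof -
  let ?Q = "\<lambda>(a :: int, b :: int). a\<^sup>2 + 2 * b\<^sup>2"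
  have "(\<Sum>p\<in>T. 1 / (real_of_int (?Q p))\<^sup>2) < 2"
  proof (rule sum_inverse_square_lt_2[OF assms])
    fix p assume "p \<in> half_plane"
    then show "snd p \<ge> 0 \<and> ?Q p > 0"
      by (auto simp: half_plane_def intro: add_nonneg_pos) 
  next
    show "(\<Sum>p\<in>lattice_box 8. if p \<in> half_plane then 10 ^ 6 div (?Q p)\<^sup>2 + 1 else 0) \<le> 1950000"
      unfolding lattice_box_def half_plane_def mem_Collect_eq by code_simp
  qed auto
  then show ?thesis by (simp add: case_prod_unfold)
qed

lemma lattice_sum_4:
  assumes "finite T" "T \<subseteq> quadrant"
  shows "(\<Sum>(a, b)\<in>T. 1 / (real_of_int (a\<^sup>2 + b\<^sup>2))\<^sup>2) < 2"
proof -
  let ?Q = "\<lambda>(a :: int, b :: int). a\<^sup>2 + b\<^sup>2"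
  have "(\<Sum>p\<in>T. 1 / (real_of_int (?Q p))\<^sup>2) < 2"
  proof (rule sum_inverse_square_lt_2[OF assms])
    fix p assume "p \<in> quadrant"
    then show "snd p \<ge> 0 \<and> ?Q p > 0"
      by (auto simp: quadrant_def intro: add_pos_nonneg) 
  next
    show "(\<Sum>p\<in>lattice_box 8. if p \<in> quadrant then 10 ^ 6 div (?Q p)\<^sup>2 + 1 else 0) \<le> 1950000"
      unfolding lattice_box_def quadrant_def mem_Collect_eq by code_simp
  qed auto
  then show ?thesis by (simp add: case_prod_unfold)
qed

section \<open>Norm forms\<close>

definition lattice_point :: "int \<Rightarrow> int \<times> int \<Rightarrow> complex" where
  "lattice_point d = (\<lambda>(a, b). of_int a + of_int b * ring_gen d)"

definition norm_form :: "int \<Rightarrow> int \<times> int \<Rightarrow> int" where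
  "norm_form d = (\<lambda>(a, b). if d mod 4 = 1 then a\<^sup>2 + a * b + (1 - d) div 4 * b\<^sup>2 else a\<^sup>2 - d * b\<^sup>2)"

definition sector :: "int \<Rightarrow> (int \<times> int) set" where
  "sector d = (if d = -1 \<or> d = -3 then quadrant else half_plane)"

lemma norm_lattice_point:
  assumes "d < 0"
  shows "(norm (lattice_point d p))\<^sup>2 = of_int (norm_form d p)"
proof (cases p)
  case (Pair a b)
  show ?thesis
  proof (cases "d mod 4 = 1")
    case True
    then have "(1 - d) mod 4 = 0" by presburger
    then obtain c where c: "1 - d = 4 * c" by auto
    then have d: "d = 1 - 4 * c" by simp
    have "(sqrt (- real_of_int d))\<^sup>2 = 4 * of_int c - 1" using assms d by simp
    then have "(real_of_int b * sqrt (- real_of_int d) / 2)\<^sup>2 = (of_int b)\<^sup>2 * (4 * of_int c - 1) / 4"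
      by (simp add: power_mult_distrib power_divide)
    moreover have "(norm (lattice_point d p))\<^sup>2 =
        (real_of_int a + real_of_int b / 2)\<^sup>2 + (real_of_int b * sqrt (- real_of_int d) / 2)\<^sup>2"
      using True assms by (simp add: Pair lattice_point_def ring_gen_def csqrt_int_def cmod_power2)
    moreover have "norm_form d p = a\<^sup>2 + a * b + c * b\<^sup>2"
      using True c by (simp add: Pair norm_form_def)
    ultimately show ?thesis by (simp add: power2_eq_square field_simps)
  next
    case False
    then show ?thesis using assms
      by (simp add: Pair lattice_point_def norm_form_def ring_gen_def csqrt_int_def cmod_power2 power_mult_distrib)
  qed
qed

lemma Im_ring_gen_pos: "d < 0 \<Longrightarrow> Im (ring_gen d) > 0"
  by (auto simp: ring_gen_def csqrt_int_def)

lemma inj_lattice_point: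
  assumes "d < 0"
  shows "inj (lattice_point d)"
proof (rule injI)
  fix p q assume eq: "lattice_point d p = lattice_point d q"
  obtain a b a' b' where p: "p = (a, b)" "q = (a', b')" by (metis surj_pair)
  have "Im (lattice_point d p) = Im (lattice_point d q)" "Re (lattice_point d p) = Re (lattice_point d q)"
    using eq by simp_all
  then show "p = q" using Im_ring_gen_pos[OF assms] by (simp add: lattice_point_def p)
qed

lemma Aset_lattice_point:
  assumes "t \<in> Aset d" "d < 0"
  obtains p where "p \<in> sector d" "t = lattice_point d p"
proof -
  from assms have t: "t \<in> OK d" "t \<noteq> 0" by (auto simp: Aset_def)
  then obtain a b where t_eq: "t = of_int a + of_int b * ring_gen d" by (auto simp: OK_iff)
  have Im: "Im t = of_int b * Im (ring_gen d)" and Re: "Re t = of_int a + of_int b * Re (ring_gen d)"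
    by (simp_all add: t_eq)
  have pos: "Im (ring_gen d) > 0" using assms(2) by (rule Im_ring_gen_pos)
  have arg: "d = -1 \<Longrightarrow> Arg2pi t < pi / 2" "d = -3 \<Longrightarrow> Arg2pi t < pi / 3"
    "d \<noteq> -1 \<Longrightarrow> d \<noteq> -3 \<Longrightarrow> Arg2pi t < pi"
    using assms(1) by (auto simp: Aset_def)
  then have arg_pi: "Arg2pi t < pi" using pi_gt_zero by linarith
  have ReIm: "Re t = norm t * cos (Arg2pi t)" "Im t = norm t * sin (Arg2pi t)"
    by (simp_all add: cos_Arg2pi sin_Arg2pi)
  have "(a, b) \<in> half_plane"
  proof (cases "Arg2pi t = 0")
    case True
    then have "Im t = 0" "Re t > 0" using ReIm t(2) by simp_all
    then show ?thesis using Im Re pos by (simp add: half_plane_def)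
  next
    case False
    then have "Im t > 0" using arg_pi Arg2pi_ge_0[of t] Arg2pi_lt_pi[of t] by linarith
    then show ?thesis using Im pos by (simp add: half_plane_def zero_less_mult_iff)
  qed
  moreover have "a > 0" if "d = -1"
  proof -
    have "cos (Arg2pi t) > 0"
      using arg(1)[OF that] Arg2pi_ge_0[of t] pi_gt_zero by (intro cos_gt_zero_pi) linarith+
    then have "Re t > 0" using ReIm t(2) by simp
    then show ?thesis using Re that by (simp add: ring_gen_def csqrt_int_def)
  qed
  moreover have "a > 0" if "d = -3"
  proof -
    \<comment> \<open>The quantity 2 * |t| * sin (pi / 3 - arg t) equals sqrt 3 * Re t - Im t, which
      is sqrt 3 * a in coordinates; so the upper edge of the sector becomes the condition a >
      0.\<close>
    have "sin (pi / 3 - Arg2pi t) > 0"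
      using arg(2)[OF that] Arg2pi_ge_0[of t] pi_gt_zero by (intro sin_gt_zero) linarith+
    then have "0 < norm t * (2 * sin (pi / 3 - Arg2pi t))" using t(2) by simp
    also have "\<dots> = sqrt 3 * Re t - Im t"
      by (simp add: ReIm sin_diff sin_60 cos_60 algebra_simps)
    also have "\<dots> = sqrt 3 * of_int a"
      unfolding Im Re using that by (simp add: ring_gen_def csqrt_int_def algebra_simps)
    finally show ?thesis by (simp add: zero_less_mult_iff)
  qed
  ultimately have "(a, b) \<in> sector d" by (auto simp: sector_def quadrant_def half_plane_def)
  then show ?thesis by (rule that) (simp add: t_eq lattice_point_def)
qed

abbreviation (input) heegner :: "int set" where
  "heegner \<equiv> {-163, -67, -43, -19, -11, -7, -3, -2, -1}"

lemma norm_form_pos: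
  assumes "d < 0" "p \<in> sector d"
  shows "norm_form d p > 0"
proof -
  have "p \<noteq> (0, 0)" using assms(2) by (auto simp: sector_def quadrant_def half_plane_def split: if_splits)
  then have "lattice_point d p \<noteq> lattice_point d (0, 0)"
    using inj_lattice_point[OF assms(1)] by (auto dest: injD)
  then have "(norm (lattice_point d p))\<^sup>2 > 0" by (simp add: lattice_point_def)
  then show ?thesis unfolding norm_lattice_point[OF assms(1)] by simp
qed

text \<open>Three forms dominate all nine cases. On the quadrant a * b \<ge> 0, so d = -3 is
  compared with d = -1; for d \<le> -7 the coefficient (1 - d) / 4 is at least 2, so the form of d =
  -7 is the smallest; d = -2 stands alone.\<close>

lemma sum_norm_form_inverse_square:
  assumes d: "d \<in> heegner" and T: "finite T" "T \<subseteq> sector d"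
  shows "(\<Sum>p\<in>T. 1 / (real_of_int (norm_form d p))\<^sup>2) < 2"
proof -
  have less: "(\<Sum>p\<in>T. 1 / (real_of_int (norm_form d p))\<^sup>2) < 2"
    if "(\<Sum>(a, b)\<in>T. 1 / (real_of_int (q a b))\<^sup>2) < 2"
      and q: "\<And>a b. (a, b) \<in> sector d \<Longrightarrow> 0 < q a b \<and> q a b \<le> norm_form d (a, b)" for q
  proof -
    have "(\<Sum>p\<in>T. 1 / (real_of_int (norm_form d p))\<^sup>2) \<le> (\<Sum>(a, b)\<in>T. 1 / (real_of_int (q a b))\<^sup>2)"
    proof (rule sum_mono, clarify)
      fix a b assume "(a, b) \<in> T"
      then have *: "0 < q a b" "q a b \<le> norm_form d (a, b)" using T(2) q by blast+
      then have "(real_of_int (q a b))\<^sup>2 \<le> (real_of_int (norm_form d (a, b)))\<^sup>2"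
        by (intro power_mono) auto
      then show "1 / (real_of_int (norm_form d (a, b)))\<^sup>2 \<le> 1 / (real_of_int (q a b))\<^sup>2"
        using * by (intro divide_left_mono mult_pos_pos) auto
    qed
    with that(1) show ?thesis by linarith
  qed
  consider "d = -1 \<or> d = -3" | "d = -2" | "d \<le> -7" "d mod 4 = 1" using d by auto
  then show ?thesis
  proof cases
    case 1
    then have "sector d = quadrant" by (auto simp: sector_def)
    with 1 T show ?thesis
      by (intro less[OF lattice_sum_4])
         (auto simp: quadrant_def norm_form_def add_pos_nonneg)
  next
    case 2
    then have "sector d = half_plane" by (auto simp: sector_def)
    with 2 T show ?thesis
      by (intro less[OF lattice_sum_8])
         (auto simp: half_plane_def norm_form_def add_nonneg_pos)
  next
    case 3
    then have s: "sector d = half_plane" by (auto simp: sector_def)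
    have "2 \<le> (1 - d) div 4" using 3 by simp
    then have "2 * b\<^sup>2 \<le> (1 - d) div 4 * b\<^sup>2" for b :: int by (intro mult_right_mono) auto
    \<comment> \<open>This form is \<open>norm_form (-7)\<close>, so its positivity is an instance
      of the general one.\<close>
    moreover have "0 < a\<^sup>2 + a * b + 2 * b\<^sup>2" if "(a, b) \<in> half_plane" for a b
      using norm_form_pos[of "-7" "(a, b)"] that by (simp add: norm_form_def sector_def)
    ultimately show ?thesis using 3 T s
      by (intro less[OF lattice_sum_7]) (auto simp: norm_form_def)
  qed
qed


section \<open>Elements of square norm\<close>

lemma card_square_solutions:
  fixes b s t :: int
  shows "finite {a. (2 * a + t * b)\<^sup>2 = s}" "card {a. (2 * a + t * b)\<^sup>2 = s} \<le> 2"
proof -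
  let ?A = "{a. (2 * a + t * b)\<^sup>2 = s}"
  have "\<exists>x y. ?A \<subseteq> {x, y}"
  proof (cases "?A = {}")
    case False
    then obtain x where x: "(2 * x + t * b)\<^sup>2 = s" by blast
    have "?A \<subseteq> {x, - x - t * b}"
    proof
      fix a assume "a \<in> ?A"
      then have "(2 * a + t * b)\<^sup>2 = (2 * x + t * b)\<^sup>2" using x by simp
      then have "2 * a + t * b = 2 * x + t * b \<or> 2 * a + t * b = - (2 * x + t * b)"
        by (simp only: power2_eq_iff)
      then have "a = x \<or> a = - x - t * b" by presburger
      then show "a \<in> {x, - x - t * b}" by simp
    qed
    then show ?thesis by blast
  qed simp
  then obtain x y where xy: "?A \<subseteq> {x, y}" by blast
  then show "finite ?A" by (rule finite_subset) simp
  have "card ?A \<le> card {x, y}" using xy by (intro card_mono) auto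
  also have "\<dots> \<le> 2" by (simp add: card_insert_if)
  finally show "card ?A \<le> 2" .
qed

text \<open>The row b = 0 contains at most the point (m, 0). Each of the rows 1, ..., K contains at
  most two points, the solutions of a quadratic equation in a.\<close>

lemma card_half_plane_square_norm:
  fixes N :: "int \<times> int \<Rightarrow> int" and t D :: int and m K :: nat
  assumes N: "\<And>a b. 4 * N (a, b) = (2 * a + t * b)\<^sup>2 + D * b\<^sup>2"
    and D: "D > 0"
    and K: "\<And>a b. b > 0 \<Longrightarrow> N (a, b) = (int m)\<^sup>2 \<Longrightarrow> b \<le> int K"
  shows "finite {p \<in> half_plane. N p = (int m)\<^sup>2}" "card {p \<in> half_plane. N p = (int m)\<^sup>2} \<le> 1 + 2 * K"
proof -
  define A where "A b = {a. (2 * a + t * b)\<^sup>2 = 4 * (int m)\<^sup>2 - D * b\<^sup>2}" for b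
  have A: "finite (A b)" "card (A b) \<le> 2" for b
    unfolding A_def by (rule card_square_solutions)+
  have sub: "{p \<in> half_plane. N p = (int m)\<^sup>2} \<subseteq> {(int m, 0)} \<union> (\<lambda>(b, a). (a, b)) ` (SIGMA b:{1..int K}. A b)"
  proof
    fix p assume p: "p \<in> {p \<in> half_plane. N p = (int m)\<^sup>2}"
    obtain a b where ab: "p = (a, b)" by (cases p)
    show "p \<in> {(int m, 0)} \<union> (\<lambda>(b, a). (a, b)) ` (SIGMA b:{1..int K}. A b)"
    proof (cases "b = 0")
      case True
      with p have "a\<^sup>2 = (int m)\<^sup>2" "a > 0" using N[of a 0] by (auto simp: ab half_plane_def)
      then have "a = int m" by (simp add: power2_eq_iff)
      with True show ?thesis by (simp add: ab)
    next
      case False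
      with p have "b > 0" "N (a, b) = (int m)\<^sup>2" by (auto simp: ab half_plane_def)
      then have "a \<in> A b" "b \<in> {1..int K}" using N[of a b] K[of b a] by (auto simp: A_def)
      then show ?thesis by (auto simp: ab image_iff)
    qed
  qed
  have finS: "finite (SIGMA b:{1..int K}. A b)" using A(1) by (intro finite_SigmaI) auto
  then show "finite {p \<in> half_plane. N p = (int m)\<^sup>2}" by (intro finite_subset[OF sub]) auto
  have "card {p \<in> half_plane. N p = (int m)\<^sup>2} \<le> card ({(int m, 0 :: int)} \<union> (\<lambda>(b, a). (a, b)) ` (SIGMA b:{1..int K}. A b))"
    using sub finS by (intro card_mono) auto
  also have "\<dots> \<le> card {(int m, 0 :: int)} + card ((\<lambda>(b, a). (a, b)) ` (SIGMA b:{1..int K}. A b))"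
    by (rule card_Un_le)
  also have "\<dots> \<le> 1 + card (SIGMA b:{1..int K}. A b)" using finS by (simp add: card_image_le)
  also have "card (SIGMA b:{1..int K}. A b) = (\<Sum>b\<in>{1..int K}. card (A b))"
    using A(1) by (intro card_SigmaI) auto
  also have "\<dots> \<le> card {1..int K} * 2" using A(2) sum_bounded_above[of "{1..int K}" "\<lambda>b. card (A b)" 2] by auto
  finally show "card {p \<in> half_plane. N p = (int m)\<^sup>2} \<le> 1 + 2 * K" by simp
qed

text \<open>For fixed a > 0 the form is strictly increasing in b \<ge> 0, so a determines the point,
  and a^2 \<le> m^2 leaves only m values of a.\<close>

lemma card_quadrant_square_norm:
  fixes N :: "int \<times> int \<Rightarrow> int" and m :: nat
  assumes N: "\<And>a b. N (a, b) = a\<^sup>2 + c * a * b + b\<^sup>2" and c: "c \<ge> 0"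
  shows "card {p \<in> quadrant. N p = (int m)\<^sup>2} \<le> m"
proof -
  let ?A = "{p \<in> quadrant. N p = (int m)\<^sup>2}"
  have inj: "inj_on fst ?A"
  proof (rule inj_onI, goal_cases)
    case (1 p q)
    obtain a b b' where ab: "p = (a, b)" "q = (a, b')" using 1(3) by (metis prod.collapse)
    have *: "a > 0" "b \<ge> 0" "b' \<ge> 0" and eq: "c * a * b + b\<^sup>2 = c * a * b' + b'\<^sup>2"
      using 1 by (auto simp: ab quadrant_def N)
    have "(b - b') * (c * a + b + b') = 0"
      using eq by (simp add: algebra_simps power2_eq_square)
    moreover have "c * a \<ge> 0" using c * by simp
    ultimately have "b = b'" using * by (auto simp: add_nonneg_eq_0_iff)
    then show ?case by (simp add: ab)
  qed
  have sub: "fst ` ?A \<subseteq> {1..int m}"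
  proof clarify
    fix a b assume "(a, b) \<in> quadrant" "N (a, b) = (int m)\<^sup>2"
    then have "a > 0" "b \<ge> 0" and eq: "a\<^sup>2 + c * a * b + b\<^sup>2 = (int m)\<^sup>2"
      by (auto simp: quadrant_def N)
    then have "c * a * b \<ge> 0" using c by simp
    then have "a\<^sup>2 \<le> (int m)\<^sup>2" using eq zero_le_power2[of b] by linarith
    then have "a \<le> int m" by (rule power2_le_imp_le) simp
    then show "fst (a, b) \<in> {1..int m}" using \<open>a > 0\<close> by simp
  qed
  have "card ?A = card (fst ` ?A)" using inj by (simp add: card_image)
  also have "\<dots> \<le> card {1..int m}" using sub by (intro card_mono) auto
  finally show "card ?A \<le> m" by simp
qed

section \<open>Two numerical series bounds\<close>

lemma sum_inverse_squares_lt_2: "(\<Sum>m\<in>{1..M}. 1 / (real m)\<^sup>2) < 2"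
proof -
  have *: "(\<Sum>m\<in>{1..M}. 1 / (real m)\<^sup>2) \<le> 2 - 1 / real M" if "M \<ge> 1" for M :: nat
    using that
  proof (induction M rule: dec_induct)
    case (step M)
    have "1 / (real (Suc M))\<^sup>2 \<le> 1 / real M - 1 / real (Suc M)"
      using step by (simp add: divide_simps power2_eq_square)
    then show ?case using step by simp
  qed simp
  show ?thesis
  proof (cases "M \<ge> 1")
    case True
    then have "1 / real M > 0" by simp
    with *[OF True] show ?thesis by linarith
  qed simp
qed

text \<open>From m = 9 on, the terms are at most 1.64 / m^2, and 1 / m^2 \<le> 1 / (m - 1) - 1 / m
  telescopes to a tail of at most 1.64 / 8 = 0.205; with the first eight terms below 1.79 the total
  is below 1.995.\<close>

lemma weighted_inverse_cubes_lt_2: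
  fixes r :: "nat \<Rightarrow> real"
  assumes r: "\<And>m. 0 \<le> r m" "\<And>m. m \<ge> 9 \<Longrightarrow> r m \<le> 41 / 25 * real m"
    and start: "(\<Sum>m\<in>{1..8}. r m / real m ^ 3) < 179 / 100"
  shows "(\<Sum>m\<in>{1..M}. r m / real m ^ 3) < 2"
proof -
  have *: "(\<Sum>m\<in>{1..M}. r m / real m ^ 3) \<le> (\<Sum>m\<in>{1..8}. r m / real m ^ 3) + 41 / 25 * (1 / 8 - 1 / real M)"
    if "M \<ge> 8" for M
    using that
  proof (induction M rule: dec_induct)
    case (step M)
    have "r (Suc M) / real (Suc M) ^ 3 \<le> (41 / 25 * real (Suc M)) / real (Suc M) ^ 3"
      using step r(2)[of "Suc M"] by (intro divide_right_mono) auto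
    also have "\<dots> = 41 / 25 * (1 / (real (Suc M))\<^sup>2)" by (simp add: divide_simps eval_nat_numeral)
    also have "1 / (real (Suc M))\<^sup>2 \<le> 1 / real M - 1 / real (Suc M)"
      using step by (simp add: divide_simps power2_eq_square)
    finally have "r (Suc M) / real (Suc M) ^ 3 \<le> 41 / 25 * (1 / real M - 1 / real (Suc M))" by simp
    moreover have "(\<Sum>m\<in>{1..Suc M}. r m / real m ^ 3) =
        (\<Sum>m\<in>{1..M}. r m / real m ^ 3) + r (Suc M) / real (Suc M) ^ 3" by simp
    ultimately show ?case using step.IH unfolding right_diff_distrib by linarith
  qed simp
  have "(\<Sum>m\<in>{1..M}. r m / real m ^ 3) \<le> (\<Sum>m\<in>{1..max 8 M}. r m / real m ^ 3)"
    using r(1) by (intro sum_mono2) auto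
  also have "\<dots> \<le> (\<Sum>m\<in>{1..8}. r m / real m ^ 3) + 41 / 25 * (1 / 8 - 1 / real (max 8 M))"
    by (rule *) simp
  also have "\<dots> \<le> (\<Sum>m\<in>{1..8}. r m / real m ^ 3) + 41 / 25 * (1 / 8)"
    by simp
  also have "\<dots> < 2" using start by simp
  finally show ?thesis .
qed

section \<open>Counting lattice points of norm m^2\<close>

lemma norm_form_discriminant:
  assumes "d < 0"
  obtains t D where "\<And>a b. 4 * norm_form d (a, b) = (2 * a + t * b)\<^sup>2 + D * b\<^sup>2"
    "D = (if d mod 4 = 1 then - d else - 4 * d)"
proof (cases "d mod 4 = 1")
  case True
  then have "(1 - d) mod 4 = 0" by presburger
  then obtain c where c: "1 - d = 4 * c" by auto
  then have d: "d = 1 - 4 * c" by simp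
  show ?thesis
    by (rule that[of 1 "- d"]) (use True c in \<open>auto simp: norm_form_def d power2_eq_square algebra_simps\<close>)
next
  case False
  then show ?thesis
    by (intro that[of 0 "- 4 * d"]) (auto simp: norm_form_def power2_eq_square algebra_simps)
qed

text \<open>A point with norm m^2 satisfies D b^2 <= (2m)^2, so b is at most 2m / sqrt D; q / 10^4 is
  an upper approximation of 2 / sqrt D.\<close>

lemma card_half_plane_norm_form:
  assumes "d < 0" and D: "D = (if d mod 4 = 1 then - d else - 4 * d)" and q: "4 * 10 ^ 8 < D * (int q)\<^sup>2"
  shows "card {p \<in> half_plane. norm_form d p = (int m)\<^sup>2} \<le> 1 + 2 * (q * m div 10 ^ 4)"
proof -
  obtain t where t: "\<And>a b. 4 * norm_form d (a, b) = (2 * a + t * b)\<^sup>2 + D * b\<^sup>2"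
    using norm_form_discriminant[OF assms(1)] D by metis
  have "D > 0" using assms(1) D by simp
  show ?thesis
  proof (rule card_half_plane_square_norm[OF t \<open>D > 0\<close>])
    fix a b assume b: "b > 0" "norm_form d (a, b) = (int m)\<^sup>2"
    have "D * b\<^sup>2 \<le> 4 * (int m)\<^sup>2" using t[of a b] b(2) by simp
    then have "4 * 10 ^ 8 * b\<^sup>2 \<le> (int q * int m)\<^sup>2 * 4"
    proof -
      have "4 * 10 ^ 8 * b\<^sup>2 \<le> D * (int q)\<^sup>2 * b\<^sup>2" using q by (intro mult_right_mono) auto
      also have "\<dots> = (int q)\<^sup>2 * (D * b\<^sup>2)" by simp
      also have "\<dots> \<le> (int q)\<^sup>2 * (4 * (int m)\<^sup>2)"
        using \<open>D * b\<^sup>2 \<le> 4 * (int m)\<^sup>2\<close> by (intro mult_left_mono) auto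
      finally show ?thesis by (simp add: power_mult_distrib)
    qed
    then have "(10 ^ 4 * b)\<^sup>2 \<le> (int (q * m))\<^sup>2" by (simp add: power_mult_distrib mult.commute)
    then have "10 ^ 4 * b \<le> int (q * m)" by (rule power2_le_imp_le) simp
    then show "b \<le> int (q * m div 10 ^ 4)" by (simp add: zdiv_int)
  qed
qed

text \<open>Comparing cardinalities by inclusion requires the larger set to be finite, so a crude
  bound b \<le> 2 * m from D \<ge> 1 is enough.\<close>

lemma finite_square_norm:
  assumes "d < 0"
  shows "finite {p \<in> sector d. norm_form d p = (int m)\<^sup>2}"
proof -
  obtain t D where t: "\<And>a b. 4 * norm_form d (a, b) = (2 * a + t * b)\<^sup>2 + D * b\<^sup>2"
    and D: "D = (if d mod 4 = 1 then - d else - 4 * d)"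
    using norm_form_discriminant[OF assms(1)] by metis
  have "D > 0" using assms(1) D by simp
  have "finite {p \<in> half_plane. norm_form d p = (int m)\<^sup>2}"
  proof (rule card_half_plane_square_norm[OF t \<open>D > 0\<close>])
    fix a b :: int assume b: "b > 0" "norm_form d (a, b) = (int m)\<^sup>2"
    have "1 * b\<^sup>2 \<le> D * b\<^sup>2" using \<open>D > 0\<close> by (intro mult_right_mono) auto
    also have "\<dots> \<le> (int (2 * m))\<^sup>2" using t[of a b] b(2) by (simp add: power_mult_distrib)
    finally have "b\<^sup>2 \<le> (int (2 * m))\<^sup>2" by simp
    then show "b \<le> int (2 * m)" by (rule power2_le_imp_le) simp
  qed
  moreover have "sector d \<subseteq> half_plane" by (auto simp: sector_def quadrant_def half_plane_def)
  ultimately show ?thesis by (auto elim!: finite_subset[rotated])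
qed

lemma sum_upto_8: "(\<Sum>m\<in>{1..8::nat}. f m) = f 1 + f 2 + f 3 + f 4 + f 5 + f 6 + f 7 + (f 8 :: real)"
proof -
  have "{1..8::nat} = {1,2,3,4,5,6,7,8}" by auto
  then show ?thesis by simp
qed

text \<open>For d = -7 the uniform count is slightly too weak and has to be improved at m = 3: 36 is not
  of the form u^2 + 7 b^2 with b > 0.\<close>

lemma card_norm_9_minus_7: "card {p \<in> half_plane. norm_form (-7) p = (int 3)\<^sup>2} \<le> 1 + 2 * 0"
proof -
  obtain t where t: "\<And>a b. 4 * norm_form (-7) (a, b) = (2 * a + t * b)\<^sup>2 + 7 * b\<^sup>2"
    by (rule norm_form_discriminant[of "-7"]) auto
  show ?thesis
  proof (rule card_half_plane_square_norm[OF t])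
    fix a b :: int assume b: "b > 0" "norm_form (-7) (a, b) = (int 3)\<^sup>2"
    define u where "u = \<bar>2 * a + t * b\<bar>"
    have eq: "u\<^sup>2 + 7 * b\<^sup>2 = 36" using t[of a b] b by (simp add: u_def)
    moreover have "b\<^sup>2 > 0" using b(1) by simp
    ultimately have "b\<^sup>2 < 9" "u\<^sup>2 < 36" using zero_le_power2[of u] by linarith+
    then have "b < 3" "u < 6"
      using power2_less_imp_less[of b 3] power2_less_imp_less[of u 6] by simp_all
    moreover have "u \<ge> 0" by (simp add: u_def)
    ultimately have "b \<in> {1, 2}" "u \<in> {0, 1, 2, 3, 4, 5}" using b(1) by auto
    \<comment> \<open>For b = 1 and b = 2 the value of u^2 would have to be 29 and 8.\<close>
    then show "b \<le> int 0" using eq by auto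
  qed simp
qed

text \<open>On the quadrant r(m) = m reduces the series to the sum of 1 / m^2. On the half plane the
  count decreases as D grows: D = 7 needs its own treatment, while all remaining cases have D \<ge>
  8 and share one count.\<close>

lemma square_norm_count:
  assumes d: "d \<in> heegner"
  obtains r :: "nat \<Rightarrow> nat" where
    "\<And>m. card {p \<in> sector d. norm_form d p = (int m)\<^sup>2} \<le> r m"
    "\<And>M. (\<Sum>m\<in>{1..M}. real (r m) / real m ^ 3) < 2"
proof -
  consider "d = -1 \<or> d = -3" | "d = -7" | "d = -2 \<or> d \<le> -11 \<and> d mod 4 = 1" using d by auto
  then show ?thesis
  proof cases
    case 1
    then have s: "sector d = quadrant" by (auto simp: sector_def)
    show ?thesis
    proof (rule that)
      show "card {p \<in> sector d. norm_form d p = (int m)\<^sup>2} \<le> m" for m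
        unfolding s using 1
        by (intro card_quadrant_square_norm[where c = "if d = -1 then 0 else 1"]) (auto simp: norm_form_def)
      have "real m / real m ^ 3 = 1 / (real m)\<^sup>2" for m by (simp add: divide_simps eval_nat_numeral)
      then show "(\<Sum>m\<in>{1..M}. real m / real m ^ 3) < 2" for M
        using sum_inverse_squares_lt_2[of M] by simp
    qed
  next
    case 2
    then have s: "sector (-7) = half_plane" by (auto simp: sector_def)
    \<comment> \<open>7560 is the least integer above 10^4 * 2 / sqrt 7. Without the correction at m
      = 3, the first eight terms would already exceed 1.79.\<close>
    define r where "r m = 1 + 2 * (if m = 3 then 0 else 7560 * m div 10 ^ 4)" for m :: nat
    show ?thesis
    proof (rule that)
      show "card {p \<in> sector d. norm_form d p = (int m)\<^sup>2} \<le> r m" for m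
        using card_norm_9_minus_7 card_half_plane_norm_form[of "-7" 7 7560 m] 2
        by (auto simp: s r_def)
      \<comment> \<open>Dropping the floor gives r(m) \<le> 1 + 1.512 * m, which is at most 1.64 * m
        as soon as m \<ge> 8.\<close>
      have "real (r m) \<le> 41 / 25 * real m" if "m \<ge> 9" for m
      proof -
        have "25 * r m \<le> 41 * m" using that unfolding r_def by simp
        then have "real (25 * r m) \<le> real (41 * m)" by (simp only: of_nat_le_iff)
        then show ?thesis by simp
      qed
      moreover have "(\<Sum>m\<in>{1..8}. real (r m) / real m ^ 3) < 179 / 100"
        unfolding sum_upto_8 r_def by simp
      ultimately show "(\<Sum>m\<in>{1..M}. real (r m) / real m ^ 3) < 2" for M
        by (intro weighted_inverse_cubes_lt_2) auto
    qed
  next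
    case 3
    then have s: "sector d = half_plane" by (auto simp: sector_def)
    \<comment> \<open>7072 is the least integer above 10^4 * 2 / sqrt 8. The first eight terms sum
      to about 1.784, just under the 1.79 required.\<close>
    define r where "r m = 1 + 2 * (7072 * m div 10 ^ 4)" for m :: nat
    have D: "8 \<le> (if d mod 4 = 1 then - d else - 4 * d)" using 3 by auto
    show ?thesis
    proof (rule that)
      have "4 * 10 ^ 8 < 8 * (int 7072)\<^sup>2" by simp
      also have "\<dots> \<le> (if d mod 4 = 1 then - d else - 4 * d) * (int 7072)\<^sup>2"
        using D by (intro mult_right_mono) auto
      finally show "card {p \<in> sector d. norm_form d p = (int m)\<^sup>2} \<le> r m" for m
        unfolding s r_def using 3 by (intro card_half_plane_norm_form[OF _ refl]) auto
      have "real (r m) \<le> 41 / 25 * real m" if "m \<ge> 9" for m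
      proof -
        have "25 * r m \<le> 41 * m" using that unfolding r_def by simp
        then have "real (25 * r m) \<le> real (41 * m)" by (simp only: of_nat_le_iff)
        then show ?thesis by simp
      qed
      moreover have "(\<Sum>m\<in>{1..8}. real (r m) / real m ^ 3) < 179 / 100"
        unfolding sum_upto_8 r_def by simp
      ultimately show "(\<Sum>m\<in>{1..M}. real (r m) / real m ^ 3) < 2" for M
        by (intro weighted_inverse_cubes_lt_2) auto
    qed
  qed
qed

text \<open>The points are grouped by their absolute value m, now a positive integer; a group has at
  most r(m) members, each contributing 1 / m^3.\<close>

lemma sum_square_norms_inverse_cube:
  assumes d: "d \<in> heegner" and T: "finite T" "T \<subseteq> sector d"
    and sq: "\<And>p. p \<in> T \<Longrightarrow> \<exists>m::nat. norm_form d p = (int m)\<^sup>2"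
  shows "(\<Sum>p\<in>T. 1 / norm (lattice_point d p) ^ 3) < 2"
proof -
  have "d < 0" using d by auto
  obtain r where r: "\<And>m. card {p \<in> sector d. norm_form d p = (int m)\<^sup>2} \<le> r m"
    "\<And>M. (\<Sum>m\<in>{1..M}. real (r m) / real m ^ 3) < 2"
    using square_norm_count[OF d] by blast
  obtain \<mu> :: "int \<times> int \<Rightarrow> nat" where \<mu>: "\<And>p. p \<in> T \<Longrightarrow> norm_form d p = (int (\<mu> p))\<^sup>2"
    using sq by metis
  have \<mu>_pos: "\<mu> p > 0" if "p \<in> T" for p
    using norm_form_pos[OF \<open>d < 0\<close>, of p] T(2) \<mu>[OF that] that by (cases "\<mu> p") auto
  have norm: "norm (lattice_point d p) = real (\<mu> p)" if "p \<in> T" for p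
  proof -
    have "(norm (lattice_point d p))\<^sup>2 = (real (\<mu> p))\<^sup>2"
      using norm_lattice_point[OF \<open>d < 0\<close>, of p] \<mu>[OF that] by simp
    then show ?thesis by (simp add: power2_eq_iff_nonneg)
  qed
  define M where "M = (\<Sum>p\<in>T. \<mu> p)"
  have M: "\<mu> ` T \<subseteq> {1..M}"
    using \<mu>_pos member_le_sum[of _ T \<mu>] T(1) by (auto simp: M_def Suc_le_eq)
  have "(\<Sum>p\<in>T. 1 / norm (lattice_point d p) ^ 3) = (\<Sum>p\<in>T. 1 / real (\<mu> p) ^ 3)"
    using norm by (intro sum.cong) auto
  also have "\<dots> = (\<Sum>m\<in>{1..M}. \<Sum>p\<in>{p\<in>T. \<mu> p = m}. 1 / real (\<mu> p) ^ 3)"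
    by (rule sum.group[OF T(1) _ M, symmetric]) simp
  also have "\<dots> = (\<Sum>m\<in>{1..M}. real (card {p\<in>T. \<mu> p = m}) / real m ^ 3)"
    by (intro sum.cong) auto
  also have "\<dots> \<le> (\<Sum>m\<in>{1..M}. real (r m) / real m ^ 3)"
  proof (intro sum_mono divide_right_mono)
    fix m assume "m \<in> {1..M}"
    have "card {p\<in>T. \<mu> p = m} \<le> card {p \<in> sector d. norm_form d p = (int m)\<^sup>2}"
      using T(2) \<mu> by (intro card_mono finite_square_norm[OF \<open>d < 0\<close>]) auto
    with r(1)[of m] show "real (card {p\<in>T. \<mu> p = m}) \<le> real (r m)" by simp
  qed simp
  also have "\<dots> < 2" by (rule r(2))
  finally show ?thesis .
qed

section \<open>The bound on I*\<close>

lemma I_star_sum_over_sector: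
  assumes "d < 0" "z \<noteq> 0"
  obtains T where "finite T" "T \<subseteq> sector d"
    "\<And>n. I_star d n z = (\<Sum>p\<in>T. 1 / norm (lattice_point d p) powi n)"
proof -
  obtain T where T: "finite T" "T \<subseteq> Aset d" "\<And>n. I_star d n z = (\<Sum>t\<in>T. 1 / norm t powi n)"
    using I_star_sum_over_Aset[OF assms(2)] by blast
  let ?P = "{p \<in> sector d. lattice_point d p \<in> T}"
  have inj: "inj_on (lattice_point d) X" for X
    using inj_lattice_point[OF assms(1)] by (rule inj_on_subset) simp
  have "T \<subseteq> lattice_point d ` ?P"
    using T(2) Aset_lattice_point[OF _ assms(1)] by blast
  then have im: "lattice_point d ` ?P = T" by auto
  show ?thesis
  proof (rule that)
    show "finite ?P" using T(1) im finite_image_iff[OF inj] by metis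
    show "?P \<subseteq> sector d" by blast
    show "I_star d n z = (\<Sum>p\<in>?P. 1 / norm (lattice_point d p) powi n)" for n
      unfolding T(3) by (subst im[symmetric], subst sum.reindex[OF inj]) simp
  qed
qed

theorem theorem2p1:
  fixes d :: int and z :: complex
  assumes "d \<in> {-163, -67, -43, -19, -11, -7, -3, -2, -1}"
    and "z \<in> OK d" and "z \<noteq> 0"
  shows "(\<forall>n::int. n \<ge> 4 \<longrightarrow> I_star d n z < 2)
         \<and> (I_star d 3 z \<in> \<rat> \<longrightarrow> I_star d 3 z < 2)"
proof -
  have "d < 0" using assms(1) by auto
  obtain T where T: "finite T" "T \<subseteq> sector d"
    and I: "\<And>n. I_star d n z = (\<Sum>p\<in>T. 1 / norm (lattice_point d p) powi n)"
    using I_star_sum_over_sector[OF \<open>d < 0\<close> assms(3)] by blast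
  have norm2: "(norm (lattice_point d p))\<^sup>2 = real_of_int (norm_form d p)" for p
    by (rule norm_lattice_point[OF \<open>d < 0\<close>])
  have pos: "norm_form d p > 0" if "p \<in> T" for p
    using norm_form_pos[OF \<open>d < 0\<close>] T(2) that by blast
  have "I_star d n z < 2" if "n \<ge> 4" for n
  proof -
    have "I_star d n z \<le> (\<Sum>p\<in>T. 1 / (real_of_int (norm_form d p))\<^sup>2)"
      unfolding I
    proof (rule sum_mono)
      fix p assume p: "p \<in> T"
      let ?x = "norm (lattice_point d p)"
      \<comment> \<open>A positive integer norm forces |y| \<ge> 1, so the terms decrease in n and
        exponent 4 is the worst case.\<close>
      have "1\<^sup>2 \<le> ?x\<^sup>2" using pos[OF p] by (simp add: norm2)
      then have "1 \<le> ?x" by (rule power2_le_imp_le) simp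
      then have "?x powi 4 \<le> ?x powi n" using that by (intro power_int_increasing) auto
      moreover have "?x powi 4 = (real_of_int (norm_form d p))\<^sup>2"
        by (simp flip: norm2 power_mult)
      ultimately show "1 / ?x powi n \<le> 1 / (real_of_int (norm_form d p))\<^sup>2"
        using \<open>1 \<le> ?x\<close> pos[OF p] by (intro divide_left_mono mult_pos_pos zero_less_power_int) auto
    qed
    also have "\<dots> < 2" by (rule sum_norm_form_inverse_square[OF assms(1) T])
    finally show ?thesis .
  qed
  moreover have "I_star d 3 z < 2" if rat: "I_star d 3 z \<in> \<rat>"
  proof -
    define c N where "c p = 1 / (real_of_int (norm_form d p))\<^sup>2" and "N p = nat (norm_form d p)" for p
    \<comment> \<open>Writing |y|^(-3) as |y|^(-4) * |y| separates the positive rational N(y)^(-2)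
      from the square root of N(y).\<close>
    have "1 / norm (lattice_point d p) powi 3 = c p * sqrt (real (N p))" if "p \<in> T" for p
    proof -
      have x: "norm (lattice_point d p) = sqrt (real (N p))"
        using pos[OF that] norm2[of p] by (simp add: N_def real_sqrt_unique)
      have "c p = 1 / norm (lattice_point d p) ^ 4" by (simp add: c_def flip: norm2 power_mult)
      moreover have "norm (lattice_point d p) \<noteq> 0" using norm2[of p] pos[OF that] by auto
      ultimately show ?thesis unfolding x[symmetric] by (simp add: divide_simps eval_nat_numeral)
    qed
    then have "I_star d 3 z = (\<Sum>p\<in>T. c p * sqrt (real (N p)))" unfolding I by (intro sum.cong) auto
    then have *: "(\<Sum>p\<in>T. c p * sqrt (real (N p))) \<in> \<rat>" using rat by simp
    have "\<exists>m::nat. norm_form d p = (int m)\<^sup>2" if "p \<in> T" for p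
    proof -
      have "\<exists>m. N p = m\<^sup>2"
        by (rule sum_sqrt_rational_imp_squares[OF T(1) _ _ * that]) (use pos in \<open>auto simp: c_def N_def dest: less_imp_neq[OF pos]\<close>)
      then obtain m where "N p = m\<^sup>2" ..
      then have "int (N p) = (int m)\<^sup>2" by simp
      then show ?thesis using pos[OF that] by (auto simp: N_def)
    qed
    then have "(\<Sum>p\<in>T. 1 / norm (lattice_point d p) ^ 3) < 2"
      by (intro sum_square_norms_inverse_cube[OF assms(1) T])
    then show ?thesis by (simp add: I)
  qed
  ultimately show ?thesis by blast
qed

end
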